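(* Let $W\in\mathbb{R}^{Kn\times MD}$ be the weight matrix of a single-layer CNN (defined in the context), and suppose that $W^T$ satisfies the $\mathcal{M}_k^2$-RIP, with constants $\delta_k\le\delta_{2k}<1$: that is, $$(1-\delta_k)\|z\|_2^2\le\|W^Tz\|_2^2\le(1+\delta_k)\|z\|_2^2\ \ \text{for all } z\in\mathcal{M}_k,$$ $$(1-\delta_{2k})\|z\|_2^2\le\|W^Tz\|_2^2\le(1+\delta_{2k})\|z\|_2^2\ \ \text{for all } z\in\mathcal{M}_k^2 .$$ Let $x=W^Tz$ for some $z\in\mathcal{M}_k$. If $W$ is used both to compute the hidden units $\hat z=\mathbb{M}(Wx,k)$ and to reconstruct the input from them as $\hat x=W^T\hat z=W^T\mathbb{M}(Wx,k)$, then $$\|\hat x-x\|_2\ \le\ \frac{5\,\delta_{2k}}{1-\delta_k}\,\frac{\sqrt{1+\delta_{2k}}}{\sqrt{1-\delta_{2k}}}\,\|x\|_2 .$$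
   Context: CNN weight matrix: let $M,K,\ell,D,t$ be positive integers, $\ell\le D$, with $n=(D-\ell)/t+1$ an integer. For filters $w_{i,m}\in\mathbb{R}^\ell$ ($1\le i\le K$, $1\le m\le M$) with coordinates $w_{i,m}(0),\dots,w_{i,m}(\ell-1)$, let $w_{i,m}^j\in\mathbb{R}^D$ ($0\le j\le n-1$) be the filter shifted by $jt$: $w_{i,m}^j(p)=w_{i,m}(p-jt)$ if $jt\le p\le jt+\ell-1$, and $0$ for the other $p\in\{0,\dots,D-1\}$. The matrix $W\in\mathbb{R}^{Kn\times MD}$ has rows indexed by pairs $(i,j)$, where the row $(i,j)$ is the concatenation $[(w_{i,1}^j)^T,\dots,(w_{i,M}^j)^T]$; rows are grouped into $K$ blocks (one for each $i$) of size $n$. Standing assumptions: $Kn\ge MD$, the rows of $W$ span $\mathbb{R}^{MD}$, and the rows have unit $\ell_2$ norm. Sparsity model: let $1\le k\le K$. Coordinates of $z\in\mathbb{R}^{Kn}$ are correspondingly divided into $K$ contiguous blocks of size $n$. $\mathcal{M}_k\subset\mathbb{R}^{Kn}$ is the set of model-$k$-sparse vectors: those having at most one non-zero entry in each block and at most $k$ non-zero entries in total. $\mathcal{M}_k^2=\{\alpha_1z_1+\alpha_2z_2:\ z_1,z_2\in\mathcal{M}_k,\ \alpha_1,\alpha_2\in\mathbb{R}\}$. Structured sparse approximation (max pooling): $\mathbb{M}(h,k)$ denotes a vector of $\mathcal{M}_k$ closest to $h\in\mathbb{R}^{Kn}$ in $\ell_2$ norm (its non-zero entries equal the corresponding entries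 of $h$; ties are broken arbitrarily). All vectors have real (possibly negative) entries and no ReLU is applied. *)

theory Defs
  imports "Jordan_Normal_Form.VS_Connect" "HOL-Analysis.L2_Norm"
begin

text \<open>
  All indices are 0-based. The position of the pair \<open>(i, j)\<close> (block \<open>i < K\<close>, offset \<open>j < n\<close>) in
  \<open>{0..<K * n}\<close> is \<open>i * n + j\<close>; likewise coordinate \<open>p < D\<close> of the \<open>m\<close>-th channel sits in
  column \<open>m * D + p\<close>.
\<close>

definition l2_norm :: "real vec \<Rightarrow> real" where
  "l2_norm v = L2_set (\<lambda>i. v $ i) {0..<dim_vec v}"

definition shifted_filter :: "nat \<Rightarrow> nat \<Rightarrow> real vec \<Rightarrow> nat \<Rightarrow> real vec" where
  "shifted_filter D t f j =
     vec D (\<lambda>p. if j * t \<le> p \<and> p < j * t + dim_vec f then f $ (p - j * t) else 0)"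

text \<open>\<open>w i m\<close> is the filter \<open>w\<^sub>i\<^sub>,\<^sub>m\<close>.\<close>

definition cnn_matrix ::
  "nat \<Rightarrow> nat \<Rightarrow> nat \<Rightarrow> nat \<Rightarrow> nat \<Rightarrow> (nat \<Rightarrow> nat \<Rightarrow> real vec) \<Rightarrow> real mat" where
  "cnn_matrix M K n D t w =
     mat (K * n) (M * D)
       (\<lambda>(r, c). shifted_filter D t (w (r div n) (c div D)) (r mod n) $ (c mod D))"

definition model_sparse :: "nat \<Rightarrow> nat \<Rightarrow> nat \<Rightarrow> real vec set" where
  "model_sparse K n k =
     {z \<in> carrier_vec (K * n).
        (\<forall>i<K. card {j. j < n \<and> z $ (i * n + j) \<noteq> 0} \<le> 1) \<and>
        card {r. r < K * n \<and> z $ r \<noteq> 0} \<le> k}"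

definition model_sparse2 :: "nat \<Rightarrow> nat \<Rightarrow> nat \<Rightarrow> real vec set" where
  "model_sparse2 K n k =
     {a1 \<cdot>\<^sub>v z1 + a2 \<cdot>\<^sub>v z2 | a1 a2 z1 z2. z1 \<in> model_sparse K n k \<and> z2 \<in> model_sparse K n k}"

definition rip_on :: "real vec set \<Rightarrow> real mat \<Rightarrow> real \<Rightarrow> bool" where
  "rip_on S A \<delta> \<longleftrightarrow>
     (\<forall>z\<in>S. (1 - \<delta>) * (l2_norm z)\<^sup>2 \<le> (l2_norm (A *\<^sub>v z))\<^sup>2 \<and>
             (l2_norm (A *\<^sub>v z))\<^sup>2 \<le> (1 + \<delta>) * (l2_norm z)\<^sup>2)"

text \<open>
  \<open>is_model_approx K n k h zh\<close> says that \<open>zh\<close> is an admissible value of \<open>M(h, k)\<close>, the structured sparse approximation of \<open>h\<close>. It is a relation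
  because ties may be broken arbitrarily. That the non-zero entries of \<open>zh\<close> agree with those of
  \<open>h\<close> is a consequence: replacing such an entry by that of \<open>h\<close> stays in the model set and would
  otherwise strictly decrease the distance.
\<close>

definition is_model_approx :: "nat \<Rightarrow> nat \<Rightarrow> nat \<Rightarrow> real vec \<Rightarrow> real vec \<Rightarrow> bool" where
  "is_model_approx K n k h zh \<longleftrightarrow>
     zh \<in> model_sparse K n k \<and>
     (\<forall>y\<in>model_sparse K n k. l2_norm (h - zh) \<le> l2_norm (h - y))"

end

theory Submission
  imports Defs
begin

text \<open>
  Write \<open>A = W\<^sup>T\<close>, \<open>h = A\<^sup>T A z\<close> and \<open>e = zh - z\<close>. Since \<open>z\<close> itself competes in the definition of
  \<open>zh\<close>, \<open>\<parallel>h - z - e\<parallel> \<le> \<parallel>h - z\<parallel>\<close>, that is, \<open>\<parallel>e\<parallel>\<^sup>2 \<le> 2 (\<langle>A e, A z\<rangle> - \<langle>e, z\<rangle>)\<close>. All combinations of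
  \<open>e\<close> and \<open>z\<close> lie in the two-fold model set, so polarization of the RIP bounds the right-hand side
  and gives \<open>\<parallel>e\<parallel> \<le> 2 \<delta>2k \<parallel>z\<parallel>\<close>. The RIP then transfers this estimate from \<open>z\<close> to \<open>x = A z\<close>, with
  a constant smaller than the one claimed.
\<close>

lemma l2_norm_square: "(l2_norm v)\<^sup>2 = v \<bullet> v"
  unfolding l2_norm_def L2_set_def scalar_prod_def
  by (simp add: sum_nonneg power2_eq_square)

lemma l2_norm_nonneg: "0 \<le> l2_norm v"
  unfolding l2_norm_def by simp

lemma scalar_prod_lincomb:
  fixes u v :: "real vec"
  assumes "u \<in> carrier_vec d" "v \<in> carrier_vec d"
  shows "(a \<cdot>\<^sub>v u + b \<cdot>\<^sub>v v) \<bullet> (a \<cdot>\<^sub>v u + b \<cdot>\<^sub>v v)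
    = a\<^sup>2 * (u \<bullet> u) + 2 * a * b * (u \<bullet> v) + b\<^sup>2 * (v \<bullet> v)"
  using assms comm_scalar_prod[OF assms]
  by (simp add: scalar_prod_add_distrib[of _ d] add_scalar_prod_distrib[of _ d]
      power2_eq_square algebra_simps)

lemma scalar_prod_diff:
  fixes u v :: "real vec"
  assumes "u \<in> carrier_vec d" "v \<in> carrier_vec d"
  shows "(u - v) \<bullet> (u - v) = u \<bullet> u - 2 * (u \<bullet> v) + v \<bullet> v"
  using assms comm_scalar_prod[OF assms]
  by (simp add: scalar_prod_minus_distrib[of _ d] minus_scalar_prod_distrib[of _ d])

text \<open>The RIP on a plane in scalar form: \<open>E\<close>, \<open>P\<close>, \<open>Z\<close>
  are the Gram entries of two vectors and \<open>E'\<close>, \<open>P'\<close>, \<open>Z'\<close>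
  those of their images. Polarization bounds \<open>P' - P\<close>, and a weighted choice of
  \<open>a\<close>, \<open>b\<close> lets half of \<open>E\<close> be absorbed on the left.\<close>

lemma rip_polarization_bound:
  fixes E P Z E' P' Z' \<epsilon> :: real
  assumes rip: "\<And>a b. \<bar>(a\<^sup>2 * E' + 2 * a * b * P' + b\<^sup>2 * Z') - (a\<^sup>2 * E + 2 * a * b * P + b\<^sup>2 * Z)\<bar>
      \<le> \<epsilon> * (a\<^sup>2 * E + 2 * a * b * P + b\<^sup>2 * Z)"
    and "0 \<le> E" "0 \<le> Z" and near: "E \<le> 2 * (P' - P)"
  shows "E \<le> (2 * \<epsilon>)\<^sup>2 * Z"
proof -
  \<comment> \<open>The upper bound at \<open>(a, b)\<close> plus the lower bound at
    \<open>(a, - b)\<close> leaves only the cross terms of the left-hand sides.\<close>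
  have polar: "4 * (a * b) * (P' - P) \<le> 2 * \<epsilon> * (a\<^sup>2 * E + b\<^sup>2 * Z)" for a b
    using rip[of a b] rip[of a "- b"] by (auto simp: abs_le_iff algebra_simps)
  consider "\<epsilon> < 0" | "\<epsilon> = 0" | "\<epsilon> > 0" by linarith
  then show ?thesis
  proof cases
    \<comment> \<open>No sign of \<open>\<epsilon>\<close> is assumed; a negative one forces
      \<open>E = 0\<close>.\<close>
    case 1
    have "0 \<le> \<epsilon> * E" using rip[of 1 0] by simp
    with 1 \<open>0 \<le> E\<close> have "E = 0" by (simp add: zero_le_mult_iff)
    then show ?thesis using \<open>0 \<le> Z\<close> by simp
  next
    case 2
    then show ?thesis using polar[of 1 1] near by simp
  next
    case 3
    \<comment> \<open>The weight \<open>b = 2 * \<epsilon>\<close> makes the coefficient of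
      \<open>E\<close> half of what \<open>near\<close> provides, since
      \<open>2 * E \<le> 4 * (P' - P)\<close>.\<close>
    have "2 * \<epsilon> * (4 * (P' - P)) \<le> 2 * \<epsilon> * (E + (2 * \<epsilon>)\<^sup>2 * Z)"
      using polar[of 1 "2 * \<epsilon>"] by (simp add: mult.assoc mult.left_commute)
    with 3 have "4 * (P' - P) \<le> E + (2 * \<epsilon>)\<^sup>2 * Z" by simp
    then show ?thesis using near by linarith
  qed
qed

text \<open>Sparsity enters only through the RIP on the span of \<open>y\<close> and
  \<open>z\<close>, and optimality only through the comparison of \<open>y\<close> with
  \<open>z\<close>.\<close>

lemma rip_nearest_error:
  fixes A :: "real mat"
  assumes A: "A \<in> carrier_mat m d" and y: "y \<in> carrier_vec d" and z: "z \<in> carrier_vec d"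
    and rip: "rip_on {a \<cdot>\<^sub>v y + b \<cdot>\<^sub>v z | a b. True} A \<epsilon>"
    and near: "l2_norm (transpose_mat A *\<^sub>v (A *\<^sub>v z) - y) \<le> l2_norm (transpose_mat A *\<^sub>v (A *\<^sub>v z) - z)"
  shows "(l2_norm (y - z))\<^sup>2 \<le> (2 * \<epsilon>)\<^sup>2 * (l2_norm z)\<^sup>2"
proof -
  define e where "e = y - z"
  define h where "h = transpose_mat A *\<^sub>v (A *\<^sub>v z)"
  have e: "e \<in> carrier_vec d" and Ae: "A *\<^sub>v e \<in> carrier_vec m" and Az: "A *\<^sub>v z \<in> carrier_vec m"
    and h: "h \<in> carrier_vec d"
    using A y z by (auto simp: e_def h_def)
  have he: "h \<bullet> e = (A *\<^sub>v e) \<bullet> (A *\<^sub>v z)"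
    unfolding h_def using transpose_vec_mult_scalar[OF A e Az] comm_scalar_prod[OF Ae Az] by simp
  have rip_ez: "\<bar>(a\<^sup>2 * ((A *\<^sub>v e) \<bullet> (A *\<^sub>v e)) + 2 * a * b * ((A *\<^sub>v e) \<bullet> (A *\<^sub>v z))
        + b\<^sup>2 * ((A *\<^sub>v z) \<bullet> (A *\<^sub>v z))) - (a\<^sup>2 * (e \<bullet> e) + 2 * a * b * (e \<bullet> z) + b\<^sup>2 * (z \<bullet> z))\<bar>
      \<le> \<epsilon> * (a\<^sup>2 * (e \<bullet> e) + 2 * a * b * (e \<bullet> z) + b\<^sup>2 * (z \<bullet> z))" for a b
  proof -
    let ?v = "a \<cdot>\<^sub>v e + b \<cdot>\<^sub>v z"
    \<comment> \<open>The pairs \<open>e, z\<close> and \<open>y, z\<close> have the same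
      combinations, so the RIP applies to \<open>?v\<close>.\<close>
    have "?v = a \<cdot>\<^sub>v y + (b - a) \<cdot>\<^sub>v z"
      unfolding e_def using y z by (intro eq_vecI) (auto simp: algebra_simps)
    then have "?v \<in> {a \<cdot>\<^sub>v y + b \<cdot>\<^sub>v z | a b. True}" by blast
    then have "(1 - \<epsilon>) * (?v \<bullet> ?v) \<le> (A *\<^sub>v ?v) \<bullet> (A *\<^sub>v ?v)"
      "(A *\<^sub>v ?v) \<bullet> (A *\<^sub>v ?v) \<le> (1 + \<epsilon>) * (?v \<bullet> ?v)"
      using rip unfolding rip_on_def l2_norm_square by blast+
    then have "\<bar>(A *\<^sub>v ?v) \<bullet> (A *\<^sub>v ?v) - ?v \<bullet> ?v\<bar> \<le> \<epsilon> * (?v \<bullet> ?v)"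
      by (simp add: abs_le_iff algebra_simps)
    moreover have "A *\<^sub>v ?v = a \<cdot>\<^sub>v (A *\<^sub>v e) + b \<cdot>\<^sub>v (A *\<^sub>v z)"
      using A e z by (simp add: mult_add_distrib_mat_vec[of _ m d] mult_mat_vec[of _ m d])
    ultimately show ?thesis
      by (simp only: scalar_prod_lincomb[OF e z] scalar_prod_lincomb[OF Ae Az])
  qed
  have "h - y = (h - z) - e"
    unfolding e_def using h y z by (intro eq_vecI) auto
  then have "(l2_norm ((h - z) - e))\<^sup>2 \<le> (l2_norm (h - z))\<^sup>2"
    using near l2_norm_nonneg by (simp add: h_def power_mono)
  \<comment> \<open>Expanding the square cancels the norm of \<open>h - z\<close>.\<close>
  then have "e \<bullet> e \<le> 2 * ((h - z) \<bullet> e)"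
    unfolding l2_norm_square using scalar_prod_diff[of "h - z" d e] h z e by simp
  also have "(h - z) \<bullet> e = (A *\<^sub>v e) \<bullet> (A *\<^sub>v z) - e \<bullet> z"
    using h z e he comm_scalar_prod[OF z e] by (simp add: minus_scalar_prod_distrib[of _ d])
  finally have near_ez: "e \<bullet> e \<le> 2 * ((A *\<^sub>v e) \<bullet> (A *\<^sub>v z) - e \<bullet> z)" .
  show ?thesis
    using rip_polarization_bound[OF rip_ez _ _ near_ez]
      zero_le_power2[of "l2_norm e"] zero_le_power2[of "l2_norm z"]
    by (simp add: l2_norm_square e_def)
qed

theorem theorem3p3:
  fixes M K l D t n k :: nat
    and w :: "nat \<Rightarrow> nat \<Rightarrow> real vec"
    and W :: "real mat"
    and \<delta>k \<delta>2k :: real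
    and x z zh xh :: "real vec"
  assumes "M > 0" "K > 0" "l > 0" "D > 0" "t > 0" "l \<le> D"
    and "real n = (real D - real l) / real t + 1"
    and "\<And>i m. i < K \<Longrightarrow> m < M \<Longrightarrow> w i m \<in> carrier_vec l"
    and "W = cnn_matrix M K n D t w"
    and "K * n \<ge> M * D"
    and "vec_space.row_space (M * D) W = carrier_vec (M * D)"
    and "\<And>r. r < K * n \<Longrightarrow> l2_norm (row W r) = 1"
    and "1 \<le> k" "k \<le> K"
    and "\<delta>k \<le> \<delta>2k" "\<delta>2k < 1"
    and "rip_on (model_sparse K n k) (transpose_mat W) \<delta>k"
    and "rip_on (model_sparse2 K n k) (transpose_mat W) \<delta>2k"
    and "z \<in> model_sparse K n k"
    and "x = transpose_mat W *\<^sub>v z"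
    and "is_model_approx K n k (W *\<^sub>v x) zh"
    and "xh = transpose_mat W *\<^sub>v zh"
  shows "l2_norm (xh - x)
    \<le> 5 * \<delta>2k / (1 - \<delta>k) * (sqrt (1 + \<delta>2k) / sqrt (1 - \<delta>2k)) * l2_norm x"
proof -
  define A where "A = transpose_mat W"
  have A: "A \<in> carrier_mat (M * D) (K * n)"
    unfolding A_def \<open>W = _\<close> cnn_matrix_def by simp
  have W: "W = transpose_mat A" unfolding A_def by simp
  have zh: "zh \<in> model_sparse K n k"
    and near: "l2_norm (W *\<^sub>v x - zh) \<le> l2_norm (W *\<^sub>v x - z)"
    using \<open>is_model_approx K n k (W *\<^sub>v x) zh\<close> \<open>z \<in> model_sparse K n k\<close>
    unfolding is_model_approx_def by auto
  have zc: "z \<in> carrier_vec (K * n)" and zhc: "zh \<in> carrier_vec (K * n)"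
    using \<open>z \<in> model_sparse K n k\<close> zh unfolding model_sparse_def by auto
  have xz: "x = A *\<^sub>v z" and xhz: "xh = A *\<^sub>v zh"
    using \<open>x = _\<close> \<open>xh = _\<close> by (simp_all add: A_def)
  define e where "e = zh - z"
  have diff: "xh - x = A *\<^sub>v e"
    unfolding xz xhz e_def using A zc zhc by (simp add: mult_minus_distrib_mat_vec)
  have span: "{a \<cdot>\<^sub>v zh + b \<cdot>\<^sub>v z | a b. True} \<subseteq> model_sparse2 K n k"
    using \<open>z \<in> model_sparse K n k\<close> zh unfolding model_sparse2_def by blast
  have rip2: "rip_on {a \<cdot>\<^sub>v zh + b \<cdot>\<^sub>v z | a b. True} A \<delta>2k"
    using \<open>rip_on (model_sparse2 K n k) _ _\<close> span unfolding rip_on_def A_def by blast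
  have err: "(l2_norm e)\<^sup>2 \<le> (2 * \<delta>2k)\<^sup>2 * (l2_norm z)\<^sup>2"
    using rip_nearest_error[OF A zhc zc rip2] near unfolding e_def W xz by simp
  have e_span: "e = 1 \<cdot>\<^sub>v zh + (- 1) \<cdot>\<^sub>v z"
    unfolding e_def using zc zhc by (intro eq_vecI) auto
  have Ae: "(l2_norm (xh - x))\<^sup>2 \<le> (1 + \<delta>2k) * (l2_norm e)\<^sup>2"
    using rip2 e_span unfolding rip_on_def diff by blast
  have rip1: "(1 - \<delta>k) * (l2_norm z)\<^sup>2 \<le> (l2_norm x)\<^sup>2"
    and rip1': "(l2_norm x)\<^sup>2 \<le> (1 + \<delta>k) * (l2_norm z)\<^sup>2"
    using \<open>rip_on (model_sparse K n k) _ _\<close> \<open>z \<in> model_sparse K n k\<close>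
    unfolding rip_on_def A_def[symmetric] xz by blast+
  show ?thesis
  proof (cases "l2_norm z = 0")
    case True
    have "l2_norm (xh - x) = 0" "l2_norm x = 0"
      using err Ae rip1' True by simp_all
    then show ?thesis by simp
  next
    case False
    then have "0 < (l2_norm z)\<^sup>2" by simp
    \<comment> \<open>The two RIP bounds at a nonzero \<open>z\<close> are compatible only if
      \<open>\<delta>k\<close> is nonnegative.\<close>
    moreover have "(1 - \<delta>k) * (l2_norm z)\<^sup>2 \<le> (1 + \<delta>k) * (l2_norm z)\<^sup>2"
      using rip1 rip1' by linarith
    ultimately have "0 \<le> \<delta>k" by simp
    with \<open>\<delta>k \<le> \<delta>2k\<close> \<open>\<delta>2k < 1\<close> have bounds: "0 \<le> \<delta>2k" "\<delta>k < 1" "0 < 1 - \<delta>2k" by simp_all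
    \<comment> \<open>As \<open>0 < 1 - \<delta>k \<le> 1\<close>, this factor can replace its
      square root, giving the denominator of the claim.\<close>
    have "(l2_norm z * (1 - \<delta>k))\<^sup>2 = (1 - \<delta>k) * ((1 - \<delta>k) * (l2_norm z)\<^sup>2)"
      by (simp add: power2_eq_square)
    also have "\<dots> \<le> 1 * (l2_norm x)\<^sup>2"
      using \<open>0 \<le> \<delta>k\<close> bounds rip1 by (intro mult_mono) auto
    finally have "(l2_norm z * (1 - \<delta>k))\<^sup>2 \<le> (l2_norm x)\<^sup>2" by simp
    then have "l2_norm z * (1 - \<delta>k) \<le> l2_norm x"
      by (rule power2_le_imp_le) (rule l2_norm_nonneg)
    then have z_le: "l2_norm z \<le> l2_norm x / (1 - \<delta>k)"
      using bounds by (simp add: pos_le_divide_eq)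
    have "l2_norm e \<le> 2 * \<delta>2k * l2_norm z"
    proof (rule power2_le_imp_le)
      show "(l2_norm e)\<^sup>2 \<le> (2 * \<delta>2k * l2_norm z)\<^sup>2"
        using err by (simp add: power_mult_distrib)
    qed (use bounds in \<open>simp add: l2_norm_nonneg\<close>)
    \<comment> \<open>The constant 2 is relaxed to the claimed 5.\<close>
    also have "\<dots> \<le> 5 * \<delta>2k * (l2_norm x / (1 - \<delta>k))"
      using bounds z_le by (intro mult_mono) (auto simp: l2_norm_nonneg)
    finally have e_le: "l2_norm e \<le> 5 * \<delta>2k / (1 - \<delta>k) * l2_norm x" by simp
    \<comment> \<open>The divisor \<open>sqrt (1 - \<delta>2k)\<close> is positive and at most 1, so
      dividing by it only enlarges the bound.\<close>
    have sqrt_le: "sqrt (1 + \<delta>2k) \<le> sqrt (1 + \<delta>2k) / sqrt (1 - \<delta>2k)"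
      using bounds by (simp add: pos_le_divide_eq mult_left_le)
    have "l2_norm (xh - x) \<le> sqrt (1 + \<delta>2k) * l2_norm e"
    proof (rule power2_le_imp_le)
      show "(l2_norm (xh - x))\<^sup>2 \<le> (sqrt (1 + \<delta>2k) * l2_norm e)\<^sup>2"
        using Ae bounds by (simp add: power_mult_distrib)
    qed (use bounds in \<open>simp add: l2_norm_nonneg\<close>)
    also have "\<dots> \<le> sqrt (1 + \<delta>2k) / sqrt (1 - \<delta>2k) * (5 * \<delta>2k / (1 - \<delta>k) * l2_norm x)"
      using e_le sqrt_le bounds by (intro mult_mono) (auto simp: l2_norm_nonneg)
    finally show ?thesis by (simp add: mult_ac)
  qed
qed

end
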